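(* For $n\in\mathbb{N}$ let $v_1,\dots,v_n$ be distinct variables, $C_1:=\{v_1,\dots,v_n\}$, $C_2:=\{v_1,\dots,v_{n-1},\overline{v_n}\}$ (XOR-clauses), and $T_n:=X_1(\{C_1,C_2\})$, where both clauses are split in the order $v_1,\dots,v_n$ with disjoint auxiliary variables. Then: (1) $n(T_n)=3n-4$ for $n\ge2$; (2) $c(T_n)=8n-12$ for $n\ge2$; (3) $\ell(T_n)=24n-40$ for $n\ge2$; (4) $T_n$ is unsatisfiable and all its clauses have length at most $3$; (5) for $n\ge3$, $\mathrm{whd}(T_n)=\mathrm{wid}(T_n)=3$; (6) for $n\ge2$ there exists a resolution refutation of $T_n$ consisting of $18n-29$ clauses in total (axioms included).
   Context: Clauses are finite sets of literals without complementary pairs ($\bot$ empty clause), clause-sets finite sets of clauses read as CNF; $n(F)=|\mathrm{var}(F)|$, $c(F)=|F|$, $\ell(F)=\sum_{C\in F}|C|$. An XOR-clause $C$ denotes $\bigoplus_{x\in C}x=0$ over $\mathbb{Z}_2$. $X_0(C)$: all clauses $D$ with $\mathrm{var}(D)=\mathrm{var}(C)$ whose number of complemented literals has parity different from that of $C$. Natural splitting of $C=\{x_1,\dots,x_m\}$ in the given order: $\{C\}$ if $m\le2$, else the XOR-clauses $\{x_1,x_2,y_2\}$, $\{y_{i-1},x_i,y_i\}$ ($3\le i\le m-1$), $\{y_{m-1},x_m\}$ with new variables $y_2,\dots,y_{m-1}$; $X_1(C)$ is the union of $X_0$ of these, and $X_1$ of a set is the union. Two clauses resolve if they clash in exactly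 one literal $x$ ($x\in C$, $\overline x\in D$), the resolvent being $(C\cup D)\setminus\{x,\overline x\}$. For unsatisfiable $F$: $\mathrm{whd}(F)$ is the least $k$ such that $\bot$ is derivable from $F$ by resolution where in each step at least one parent has length $\le k$; $\mathrm{wid}(F)$ is the least $k$ such that $\bot$ is derivable with all clauses (axioms and resolvents) of length $\le k$. *)

theory Defs
  imports Main
begin

datatype 'a lit = Pos (lit_var: 'a) | Neg (lit_var: 'a)

fun compl_lit :: "'a lit \<Rightarrow> 'a lit" where
  "compl_lit (Pos v) = Neg v"
| "compl_lit (Neg v) = Pos v"

fun is_neg :: "'a lit \<Rightarrow> bool" where
  "is_neg (Pos v) = False"
| "is_neg (Neg v) = True"

type_synonym 'a clause = "'a lit set"
type_synonym 'a clause_set = "'a clause set"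

definition is_clause :: "'a clause \<Rightarrow> bool" where
  "is_clause C \<longleftrightarrow> finite C \<and> (\<forall>l\<in>C. compl_lit l \<notin> C)"

definition clause_var :: "'a clause \<Rightarrow> 'a set" where
  "clause_var C = lit_var ` C"

definition var :: "'a clause_set \<Rightarrow> 'a set" where
  "var F = (\<Union>C\<in>F. clause_var C)"

definition num_vars :: "'a clause_set \<Rightarrow> nat" where
  "num_vars F = card (var F)"

definition num_clauses :: "'a clause_set \<Rightarrow> nat" where
  "num_clauses F = card F"

definition num_lits :: "'a clause_set \<Rightarrow> nat" where
  "num_lits F = (\<Sum>C\<in>F. card C)"

fun lit_true :: "('a \<Rightarrow> bool) \<Rightarrow> 'a lit \<Rightarrow> bool" where
  "lit_true f (Pos v) = f v"
| "lit_true f (Neg v) = (\<not> f v)"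

definition satisfiable :: "'a clause_set \<Rightarrow> bool" where
  "satisfiable F \<longleftrightarrow> (\<exists>f. \<forall>C\<in>F. \<exists>l\<in>C. lit_true f l)"

definition num_neg :: "'a clause \<Rightarrow> nat" where
  "num_neg C = card {l \<in> C. is_neg l}"

definition X0 :: "'a clause \<Rightarrow> 'a clause_set" where
  "X0 C = {D. is_clause D \<and> clause_var D = clause_var C \<and>
              (even (num_neg D) \<longleftrightarrow> odd (num_neg C))}"

text \<open>An ordered XOR-clause is the list of its literals \<open>x\<^sub>1, \<dots>, x\<^sub>m\<close>; as lists are indexed
  from 0, \<open>x\<^sub>i\<close> is \<open>xs ! (i - 1)\<close>. The new variables \<open>y\<^sub>2, \<dots>, y\<^bsub>m-1\<^esub>\<close> are passed explicitly as
  the function \<open>y\<close>.\<close>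

definition natural_splitting :: "(nat \<Rightarrow> 'a) \<Rightarrow> 'a lit list \<Rightarrow> 'a clause set" where
  "natural_splitting y xs =
     (let m = length xs; x = (\<lambda>i. xs ! (i - 1)) in
      if m \<le> 2 then {set xs}
      else {{x 1, x 2, Pos (y 2)}}
           \<union> {{Pos (y (i - 1)), x i, Pos (y i)} | i. 3 \<le> i \<and> i \<le> m - 1}
           \<union> {{Pos (y (m - 1)), x m}})"

text \<open>The function \<open>aux\<close> assigns to each ordered XOR-clause of a set its own auxiliary
  variables.\<close>

definition X1 :: "('a lit list \<Rightarrow> nat \<Rightarrow> 'a) \<Rightarrow> 'a lit list set \<Rightarrow> 'a clause_set" where
  "X1 aux F = (\<Union>xs\<in>F. \<Union>D\<in>natural_splitting (aux xs) xs. X0 D)"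

definition aux_vars :: "('a lit list \<Rightarrow> nat \<Rightarrow> 'a) \<Rightarrow> 'a lit list \<Rightarrow> 'a set" where
  "aux_vars aux xs = aux xs ` {2..length xs - 1}"

definition fresh_aux :: "('a lit list \<Rightarrow> nat \<Rightarrow> 'a) \<Rightarrow> 'a lit list set \<Rightarrow> bool" where
  "fresh_aux aux F \<longleftrightarrow>
     (\<forall>xs\<in>F. inj_on (aux xs) {2..length xs - 1} \<and> aux_vars aux xs \<inter> var (set ` F) = {}) \<and>
     (\<forall>xs\<in>F. \<forall>ys\<in>F. xs \<noteq> ys \<longrightarrow> aux_vars aux xs \<inter> aux_vars aux ys = {})"

definition resolvable :: "'a lit \<Rightarrow> 'a clause \<Rightarrow> 'a clause \<Rightarrow> bool" where
  "resolvable x C D \<longleftrightarrow> {l \<in> C. compl_lit l \<in> D} = {x}"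

definition resolvent :: "'a lit \<Rightarrow> 'a clause \<Rightarrow> 'a clause \<Rightarrow> 'a clause" where
  "resolvent x C D = (C \<union> D) - {x, compl_lit x}"

inductive whd_derivable :: "nat \<Rightarrow> 'a clause_set \<Rightarrow> 'a clause \<Rightarrow> bool"
  for k :: nat and F :: "'a clause_set" where
  whd_axiom: "C \<in> F \<Longrightarrow> whd_derivable k F C"
| whd_resolve: "whd_derivable k F C \<Longrightarrow> whd_derivable k F D \<Longrightarrow> resolvable x C D \<Longrightarrow>
    card C \<le> k \<or> card D \<le> k \<Longrightarrow> whd_derivable k F (resolvent x C D)"

inductive wid_derivable :: "nat \<Rightarrow> 'a clause_set \<Rightarrow> 'a clause \<Rightarrow> bool"
  for k :: nat and F :: "'a clause_set" where
  wid_axiom: "C \<in> F \<Longrightarrow> card C \<le> k \<Longrightarrow> wid_derivable k F C"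
| wid_resolve: "wid_derivable k F C \<Longrightarrow> wid_derivable k F D \<Longrightarrow> resolvable x C D \<Longrightarrow>
    card (resolvent x C D) \<le> k \<Longrightarrow> wid_derivable k F (resolvent x C D)"

text \<open>Meaningful only for unsatisfiable clause-sets; otherwise no such \<open>k\<close> exists.\<close>

definition whd :: "'a clause_set \<Rightarrow> nat" where
  "whd F = (LEAST k. whd_derivable k F {})"

definition wid :: "'a clause_set \<Rightarrow> nat" where
  "wid F = (LEAST k. wid_derivable k F {})"

definition resolution_refutation :: "'a clause_set \<Rightarrow> 'a clause list \<Rightarrow> bool" where
  "resolution_refutation F Cs \<longleftrightarrow>
     Cs \<noteq> [] \<and> last Cs = {} \<and>
     (\<forall>i < length Cs. Cs ! i \<in> F \<or>
        (\<exists>j < i. \<exists>k < i. \<exists>x. resolvable x (Cs ! j) (Cs ! k) \<and>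
                             Cs ! i = resolvent x (Cs ! j) (Cs ! k)))"

definition C1 :: "(nat \<Rightarrow> 'a) \<Rightarrow> nat \<Rightarrow> 'a lit list" where
  "C1 v n = map (\<lambda>i. Pos (v i)) [1..<n + 1]"

definition C2 :: "(nat \<Rightarrow> 'a) \<Rightarrow> nat \<Rightarrow> 'a lit list" where
  "C2 v n = map (\<lambda>i. Pos (v i)) [1..<n] @ [Neg (v n)]"

definition T :: "(nat \<Rightarrow> 'a) \<Rightarrow> ('a lit list \<Rightarrow> nat \<Rightarrow> 'a) \<Rightarrow> nat \<Rightarrow> 'a clause_set" where
  "T v aux n = X1 aux {C1 v n, C2 v n}"

end

theory Submission
  imports Defs
begin

text \<open>
  Write \<open>y\<^sub>i\<close> and \<open>z\<^sub>i\<close> for the auxiliary variables of the two splittings. The refutation derives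
  the equivalences \<open>y\<^sub>i = z\<^sub>i\<close> one after the other: 6 resolvents give \<open>y\<^sub>2 = z\<^sub>2\<close>, and 10 resolvents
  of length at most 3 lead from \<open>y\<^sub>i = z\<^sub>i\<close> to \<open>y\<^bsub>i+1\<^esub> = z\<^bsub>i+1\<^esub>\<close>. The last equivalence
  contradicts \<open>y\<^bsub>n-1\<^esub> = v\<^sub>n\<close> and \<open>z\<^bsub>n-1\<^esub> \<noteq> v\<^sub>n\<close>. Conversely, the only clauses of length at most 2
  state (in)equalities between \<open>y\<^bsub>n-1\<^esub>\<close>, \<open>z\<^bsub>n-1\<^esub>\<close> and \<open>v\<^sub>n\<close>, and every other clause contains at
  most one of these three variables; resolving with such a 2-clause only renames a literal and
  never shortens a clause.
\<close>

section \<open>Signed literals and small parity constraints\<close>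

text \<open>Carrying the sign as a boolean turns complementation into negation and parity conditions
  into equations between booleans, so that one argument can treat several sign patterns at
  once.\<close>

definition lt :: "bool \<Rightarrow> 'a \<Rightarrow> 'a lit" where
  "lt s x = (if s then Pos x else Neg x)"

lemma lt_eq_iff [simp]: "lt s x = lt t y \<longleftrightarrow> s = t \<and> x = y"
  by (auto simp: lt_def)

lemma compl_lt [simp]: "compl_lit (lt s x) = lt (\<not> s) x"
  by (auto simp: lt_def)

lemma lit_var_lt [simp]: "lit_var (lt s x) = x"
  by (auto simp: lt_def)

lemma is_neg_lt [simp]: "is_neg (lt s x) \<longleftrightarrow> \<not> s"
  by (auto simp: lt_def)

lemma lit_cases_lt: obtains s x where "l = lt s x"
proof (cases l)
  case (Pos x)
  then have "l = lt True x" by (simp add: lt_def)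
  then show ?thesis by (rule that)
next
  case (Neg x)
  then have "l = lt False x" by (simp add: lt_def)
  then show ?thesis by (rule that)
qed

section \<open>Clauses with a prescribed variable set, and their sign parity\<close>

lemma clause_var_empty [simp]: "clause_var {} = {}"
  by (simp add: clause_var_def)

lemma clause_var_insert [simp]: "clause_var (insert l C) = insert (lit_var l) (clause_var C)"
  by (simp add: clause_var_def)

lemma clause_var_empty_iff [simp]: "clause_var C = {} \<longleftrightarrow> C = {}"
  by (simp add: clause_var_def)

lemma lt_notin_if_var_notin: "x \<notin> clause_var C \<Longrightarrow> lt s x \<notin> C"
  by (force simp: clause_var_def)

lemma is_clause_insert_lt:
  assumes "x \<notin> clause_var C"
  shows "is_clause (insert (lt s x) C) \<longleftrightarrow> is_clause C"
proof -
  have "compl_lit l \<noteq> lt s x" if "l \<in> C" for l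
    using that lt_notin_if_var_notin[OF assms] by (cases l rule: lit_cases_lt) auto
  then show ?thesis
    using lt_notin_if_var_notin[OF assms] unfolding is_clause_def by auto
qed

text \<open>Since \<open>D\<close> has no complementary pair, deleting its literal on
  \<open>x\<close> also removes the variable \<open>x\<close>. Applied once per variable, this
  leaves only the signs of a clause as unknowns, which is how the sets \<open>X0\<close> are
  computed below.\<close>

lemma clause_remove_var:
  assumes D: "is_clause D" and var: "clause_var D = insert x V" and x: "x \<notin> V"
  obtains s D' where "D = insert (lt s x) D'" "is_clause D'" "clause_var D' = V"
proof -
  from var obtain l where l: "l \<in> D" "lit_var l = x"
    unfolding clause_var_def by (metis imageE insertI1)
  obtain s where s: "l = lt s x" using l(2) by (metis lit_cases_lt lit_var_lt)
  define D' where "D' = D - {lt s x}"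
  have 1: "D = insert (lt s x) D'" using l s by (auto simp: D'_def)
  have 2: "is_clause D'" using D by (auto simp: is_clause_def D'_def)
  have "lt (\<not> s) x \<notin> D" using D l(1) s by (auto simp: is_clause_def)
  have "x \<notin> clause_var D'"
  proof
    assume "x \<in> clause_var D'"
    then obtain k where k: "k \<in> D'" "lit_var k = x" by (auto simp: clause_var_def)
    obtain t where "k = lt t x" using k(2) by (metis lit_cases_lt lit_var_lt)
    then show False using k \<open>lt (\<not> s) x \<notin> D\<close> by (cases "t = s") (auto simp: D'_def)
  qed
  moreover have "insert x (clause_var D') = insert x V" using var 1 by simp
  ultimately have "clause_var D' = V" using x by (simp add: insert_ident)
  then show ?thesis using 1 2 that by blast
qed

lemma num_neg_empty [simp]: "num_neg {} = 0"
  by (simp add: num_neg_def)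

lemma even_num_neg_insert_lt:
  assumes "x \<notin> clause_var C" "finite C"
  shows "even (num_neg (insert (lt s x) C)) \<longleftrightarrow> (s \<longleftrightarrow> even (num_neg C))"
proof (cases s)
  case True
  then have "{l \<in> insert (lt s x) C. is_neg l} = {l \<in> C. is_neg l}" by auto
  then show ?thesis using True by (simp add: num_neg_def)
next
  case False
  then have "{l \<in> insert (lt s x) C. is_neg l} = insert (lt s x) {l \<in> C. is_neg l}" by auto
  then show ?thesis using False assms lt_notin_if_var_notin[OF assms(1)]
    by (simp add: num_neg_def)
qed

text \<open>The CNF of a two-variable parity constraint: \<open>s = False\<close> encodes a = b, and
  \<open>s = True\<close> encodes a different from b.\<close>

definition xor2 :: "bool \<Rightarrow> 'a \<Rightarrow> 'a \<Rightarrow> 'a clause_set" where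
  "xor2 s a b = {{lt p a, lt (p = s) b} | p. True}"

text \<open>The CNF of c = a xor b. Every clause has an odd number of negations and thus excludes
  exactly one assignment of odd parity.\<close>

definition xor3 :: "'a \<Rightarrow> 'a \<Rightarrow> 'a \<Rightarrow> 'a clause_set" where
  "xor3 a b c = {{lt p a, lt q b, lt (p \<noteq> q) c} | p q. True}"

lemma xor2_explicit: "xor2 s a b = {{lt True a, lt s b}, {lt False a, lt (\<not> s) b}}"
  unfolding xor2_def by (auto simp: ex_bool_eq)

lemma xor3_explicit:
  "xor3 a b c =
    {{lt True a, lt True b, lt False c}, {lt True a, lt False b, lt True c},
     {lt False a, lt True b, lt True c}, {lt False a, lt False b, lt False c}}"
  unfolding xor3_def by (auto simp: ex_bool_eq)

lemma is_clause_empty [simp]: "is_clause {}"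
  by (simp add: is_clause_def)

lemma X0_unit: "X0 {lt s a} = {{lt (\<not> s) a}}"
proof (intro set_eqI iffI)
  fix D assume "D \<in> X0 {lt s a}"
  then have D: "is_clause D" "clause_var D = {a}"
    "even (num_neg D) \<longleftrightarrow> odd (num_neg {lt s a})" by (auto simp: X0_def)
  from clause_remove_var[OF D(1,2)] obtain p where "D = {lt p a}"
    by (metis clause_var_empty_iff empty_iff)
  then show "D \<in> {{lt (\<not> s) a}}" using D(3) by (auto simp: even_num_neg_insert_lt)
qed (auto simp: X0_def is_clause_insert_lt even_num_neg_insert_lt)

text \<open>Two positive literals as an XOR-clause say a = b, which is \<open>xor2 False\<close>;
  this is why the sign is negated. After both variables are peeled off, the parity condition
  determines the second sign from the first.\<close>

lemma X0_pair:
  assumes "a \<noteq> b"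
  shows "X0 {lt True a, lt s b} = xor2 (\<not> s) a b"
proof (intro set_eqI iffI)
  fix D assume "D \<in> X0 {lt True a, lt s b}"
  then have D: "is_clause D" "clause_var D = {a, b}"
    "even (num_neg D) \<longleftrightarrow> odd (num_neg {lt True a, lt s b})" by (auto simp: X0_def)
  obtain p D' where D': "D = insert (lt p a) D'" "is_clause D'" "clause_var D' = {b}"
    using clause_remove_var[OF D(1,2)] assms by blast
  obtain q where "D' = {lt q b}"
    using clause_remove_var[OF D'(2,3)] by (metis clause_var_empty_iff empty_iff)
  then show "D \<in> xor2 (\<not> s) a b" using D(3) D'(1) assms
    by (cases p; cases s) (auto simp: even_num_neg_insert_lt xor2_explicit)
qed (use assms in \<open>auto simp: X0_def is_clause_insert_lt even_num_neg_insert_lt xor2_explicit\<close>)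

lemma X0_triple:
  assumes "a \<noteq> b" "a \<noteq> c" "b \<noteq> c"
  shows "X0 {lt True a, lt True b, lt True c} = xor3 a b c"
proof (intro set_eqI iffI)
  fix D assume "D \<in> X0 {lt True a, lt True b, lt True c}"
  then have D: "is_clause D" "clause_var D = {a, b, c}"
    "even (num_neg D) \<longleftrightarrow> odd (num_neg {lt True a, lt True b, lt True c})"
    by (auto simp: X0_def)
  obtain p D' where D': "D = insert (lt p a) D'" "is_clause D'" "clause_var D' = {b, c}"
    using clause_remove_var[OF D(1,2)] assms by blast
  obtain q D'' where D'': "D' = insert (lt q b) D''" "is_clause D''" "clause_var D'' = {c}"
    using clause_remove_var[OF D'(2,3)] assms by blast
  obtain r where "D'' = {lt r c}"
    using clause_remove_var[OF D''(2,3)] by (metis clause_var_empty_iff empty_iff)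
  then show "D \<in> xor3 a b c" using D(3) D'(1) D''(1) assms
    by (cases p; cases q) (auto simp: even_num_neg_insert_lt xor3_explicit)
qed (use assms in \<open>auto simp: X0_def is_clause_insert_lt even_num_neg_insert_lt xor3_explicit\<close>)

lemma card_xor2: "a \<noteq> b \<Longrightarrow> card (xor2 s a b) = 2"
  by (simp add: xor2_explicit set_eq_subset)

lemma card_xor3: "a \<noteq> b \<Longrightarrow> a \<noteq> c \<Longrightarrow> b \<noteq> c \<Longrightarrow> card (xor3 a b c) = 4"
  by (simp add: xor3_explicit set_eq_subset)

lemma finite_xor [simp]: "finite (xor2 s a b)" "finite (xor3 a b c)"
  by (simp_all add: xor2_explicit xor3_explicit)

lemma clause_var_xor2: "C \<in> xor2 s a b \<Longrightarrow> clause_var C = {a, b}"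
  by (auto simp: xor2_def)

lemma clause_var_xor3: "C \<in> xor3 a b c \<Longrightarrow> clause_var C = {a, b, c}"
  by (auto simp: xor3_def)

lemma card_in_xor2: "C \<in> xor2 s a b \<Longrightarrow> a \<noteq> b \<Longrightarrow> card C = 2"
  by (auto simp: xor2_def)

lemma card_in_xor3: "C \<in> xor3 a b c \<Longrightarrow> a \<noteq> b \<Longrightarrow> a \<noteq> c \<Longrightarrow> b \<noteq> c \<Longrightarrow> card C = 3"
  by (auto simp: xor3_def)

lemma var_xor2 [simp]: "var (xor2 s a b) = {a, b}"
  by (auto simp: var_def xor2_explicit)

lemma var_xor3 [simp]: "var (xor3 a b c) = {a, b, c}"
  by (auto simp: var_def xor3_explicit)

lemma var_Un [simp]: "var (F \<union> G) = var F \<union> var G"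
  by (auto simp: var_def)

lemma var_UN [simp]: "var (\<Union>i\<in>I. F i) = (\<Union>i\<in>I. var (F i))"
  by (auto simp: var_def)

section \<open>Resolution\<close>

text \<open>Derivations are recorded as the set of clauses obtained so far. The exact size of a
  refutation can then be computed as the cardinality of a disjoint union.\<close>

inductive derivation :: "'a clause_set \<Rightarrow> 'a clause_set \<Rightarrow> bool" for F where
  empty: "derivation F {}"
| axiom: "derivation F S \<Longrightarrow> C \<in> F \<Longrightarrow> derivation F (insert C S)"
| resolve: "derivation F S \<Longrightarrow> C \<in> S \<Longrightarrow> D \<in> S \<Longrightarrow> resolvable x C D \<Longrightarrow>
    derivation F (insert (resolvent x C D) S)"

lemma derivation_finite: "derivation F S \<Longrightarrow> finite S"
  by (induction rule: derivation.induct) auto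

lemma derivation_axioms: "finite G \<Longrightarrow> G \<subseteq> F \<Longrightarrow> derivation F G"
  by (induction rule: finite_induct) (auto intro: derivation.intros)

lemma derivation_wid:
  assumes "derivation F S" "\<forall>C\<in>S. card C \<le> k"
  shows "\<forall>C\<in>S. wid_derivable k F C"
  using assms by (induction rule: derivation.induct) (auto intro: wid_derivable.intros)

text \<open>Every clause of a width-k derivation is itself of length at most k, so the condition on
  the parents holds at each step. Hence lower bounds for \<open>whd\<close> carry over to
  \<open>wid\<close>.\<close>

lemma wid_imp_whd:
  "wid_derivable k F C \<Longrightarrow> card C \<le> k \<and> whd_derivable k F C"
  by (induction rule: wid_derivable.induct) (auto intro: whd_derivable.intros)

lemma whd_mono: "whd_derivable k F C \<Longrightarrow> k \<le> k' \<Longrightarrow> whd_derivable k' F C"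
proof (induction rule: whd_derivable.induct)
  case (whd_resolve C D x)
  then show ?case by (intro whd_derivable.whd_resolve) auto
qed (rule whd_derivable.whd_axiom)

lemma lit_true_compl [simp]: "lit_true f (compl_lit l) \<longleftrightarrow> \<not> lit_true f l"
  by (cases l) auto

lemma compl_compl [simp]: "compl_lit (compl_lit l) = l"
  by (cases l) auto

text \<open>Soundness needs non-tautological premises: a parent containing both \<open>x\<close> and its
  complement would lose both literals in the resolvent.\<close>

lemma is_clause_resolvent:
  assumes C: "is_clause C" and D: "is_clause D" and x: "resolvable x C D"
  shows "is_clause (resolvent x C D)"
proof -
  have clash: "l = x" if "l \<in> C" "compl_lit l \<in> D" for l
    using x that unfolding resolvable_def by blast
  have "compl_lit l \<notin> resolvent x C D" if "l \<in> resolvent x C D" for l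
    using that C D clash[of l] clash[of "compl_lit l"]
    unfolding is_clause_def resolvent_def by auto
  then show ?thesis using C D by (simp add: is_clause_def resolvent_def)
qed

lemma wid_sound:
  assumes "wid_derivable k F C" "\<forall>C\<in>F. is_clause C \<and> (\<exists>l\<in>C. lit_true f l)"
  shows "is_clause C \<and> (\<exists>l\<in>C. lit_true f l)"
  using assms
proof (induction rule: wid_derivable.induct)
  case (wid_resolve C D x)
  then have cl: "is_clause C" "is_clause D" by auto
  have x: "x \<in> C" "compl_lit x \<in> D" using wid_resolve.hyps unfolding resolvable_def by blast+
  obtain l k where l: "l \<in> C" "lit_true f l" and k: "k \<in> D" "lit_true f k"
    using wid_resolve by blast
  have "\<exists>l\<in>resolvent x C D. lit_true f l"
  proof (cases "lit_true f x")
    case True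
    then have "k \<noteq> compl_lit x" using k(2) by auto
    moreover have "k \<noteq> x" using cl(2) x(2) k(1) by (auto simp: is_clause_def)
    ultimately show ?thesis using k by (auto simp: resolvent_def)
  next
    case False
    then have "l \<noteq> x" using l(2) by auto
    moreover have "l \<noteq> compl_lit x" using cl(1) x(1) l(1) by (auto simp: is_clause_def)
    ultimately show ?thesis using l by (auto simp: resolvent_def)
  qed
  then show ?case using is_clause_resolvent[OF cl wid_resolve.hyps(3)] by blast
qed auto

section \<open>From derived clause-sets to refutation lists\<close>

definition derivation_list :: "'a clause_set \<Rightarrow> 'a clause list \<Rightarrow> bool" where
  "derivation_list F Cs \<longleftrightarrow>
     (\<forall>i < length Cs. Cs ! i \<in> F \<or>
        (\<exists>j < i. \<exists>k < i. \<exists>x. resolvable x (Cs ! j) (Cs ! k) \<and>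
                             Cs ! i = resolvent x (Cs ! j) (Cs ! k)))"

lemma derivation_list_snoc:
  assumes "derivation_list F Cs"
    and "C \<in> F \<or> (\<exists>A\<in>set Cs. \<exists>B\<in>set Cs. \<exists>x. resolvable x A B \<and> C = resolvent x A B)"
  shows "derivation_list F (Cs @ [C])"
  unfolding derivation_list_def
proof (intro allI impI)
  fix i assume "i < length (Cs @ [C])"
  then consider "i < length Cs" | "i = length Cs" by fastforce
  then show "(Cs @ [C]) ! i \<in> F \<or>
        (\<exists>j < i. \<exists>k < i. \<exists>x. resolvable x ((Cs @ [C]) ! j) ((Cs @ [C]) ! k) \<and>
             (Cs @ [C]) ! i = resolvent x ((Cs @ [C]) ! j) ((Cs @ [C]) ! k))"
  proof cases
    case 1
    then have nth: "(Cs @ [C]) ! j = Cs ! j" if "j \<le> i" for j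
      using that by (simp add: nth_append)
    show ?thesis
      using assms(1) 1 unfolding derivation_list_def by (metis nth less_imp_le order.refl)
  next
    case 2
    from assms(2) show ?thesis
    proof
      assume "\<exists>A\<in>set Cs. \<exists>B\<in>set Cs. \<exists>x. resolvable x A B \<and> C = resolvent x A B"
      then obtain j k x where "j < i" "k < i" "resolvable x (Cs ! j) (Cs ! k)"
        "C = resolvent x (Cs ! j) (Cs ! k)"
        unfolding 2 by (metis in_set_conv_nth)
      moreover from this have "(Cs @ [C]) ! j = Cs ! j" "(Cs @ [C]) ! k = Cs ! k"
        "(Cs @ [C]) ! i = C" using 2 by (simp_all add: nth_append)
      ultimately show ?thesis by metis
    qed (simp add: 2)
  qed
qed

text \<open>The list grows at its end, and only when the clause is new. It is therefore
  repetition-free, and its length is the cardinality of \<open>S\<close>.\<close>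

lemma derivation_obtain_list:
  assumes "derivation F S"
  shows "\<exists>Cs. derivation_list F Cs \<and> distinct Cs \<and> set Cs = S"
  using assms
proof (induction rule: derivation.induct)
  case empty
  then show ?case by (auto simp: derivation_list_def)
next
  case (axiom S C)
  then obtain Cs where Cs: "derivation_list F Cs" "distinct Cs" "set Cs = S" by blast
  show ?case
  proof (cases "C \<in> S")
    case True
    then show ?thesis using Cs by (auto simp: insert_absorb)
  next
    case False
    then show ?thesis using Cs axiom.hyps
      by (intro exI[of _ "Cs @ [C]"]) (auto intro: derivation_list_snoc)
  qed
next
  case (resolve S C D x)
  then obtain Cs where Cs: "derivation_list F Cs" "distinct Cs" "set Cs = S" by blast
  show ?case
  proof (cases "resolvent x C D \<in> S")
    case True
    then show ?thesis using Cs by (auto simp: insert_absorb)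
  next
    case False
    then show ?thesis using Cs resolve.hyps
      by (intro exI[of _ "Cs @ [resolvent x C D]"]) (auto intro!: derivation_list_snoc)
  qed
qed

lemma resolvable_units:
  "resolvable (lt s x) {lt s x} {lt (\<not> s) x}" "resolvent (lt s x) {lt s x} {lt (\<not> s) x} = {}"
  by (auto simp: resolvable_def resolvent_def)

text \<open>The two units resolve to the empty clause, which is appended last. As it is not in
  \<open>S\<close>, the list stays distinct and has one entry more than \<open>S\<close>.\<close>

lemma derivation_refutation:
  assumes "derivation F S" "{} \<notin> S" "{lt True x} \<in> S" "{lt False x} \<in> S"
  shows "\<exists>Cs. resolution_refutation F Cs \<and> distinct Cs \<and> length Cs = Suc (card S)"
proof -
  obtain Cs where Cs: "derivation_list F Cs" "distinct Cs" "set Cs = S"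
    using derivation_obtain_list[OF assms(1)] by blast
  have "derivation_list F (Cs @ [{}])"
    using resolvable_units[of True x] assms(3,4) Cs
    by (intro derivation_list_snoc) (auto, metis)
  moreover have "card S = length Cs" using Cs distinct_card by blast
  ultimately show ?thesis using Cs assms(2)
    by (intro exI[of _ "Cs @ [{}]"])
       (auto simp: resolution_refutation_def derivation_list_def)
qed

text \<open>The form in which all concrete resolution steps are carried out: side clauses free of
  \<open>x\<close> and without a clash make \<open>x\<close> the only clashing variable. The
  resolvent has its own name \<open>E\<close>, so that an explicit clause can be matched first and
  compared with the union afterwards.\<close>

lemma derivation_resolve_on:
  assumes "derivation F S" "insert (lt s x) C \<in> S" "insert (lt (\<not> s) x) D \<in> S"
    and "x \<notin> clause_var C" "x \<notin> clause_var D" "\<forall>l\<in>C. compl_lit l \<notin> D" "E = C \<union> D"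
  shows "derivation F (insert E S)"
proof -
  note notin = lt_notin_if_var_notin[OF assms(4)] lt_notin_if_var_notin[OF assms(5)]
  have "l = lt s x" if "l \<in> insert (lt s x) C" "compl_lit l \<in> insert (lt (\<not> s) x) D" for l
    using that assms(6) notin by (cases l rule: lit_cases_lt) auto
  then have "resolvable (lt s x) (insert (lt s x) C) (insert (lt (\<not> s) x) D)"
    unfolding resolvable_def by auto
  moreover have "resolvent (lt s x) (insert (lt s x) C) (insert (lt (\<not> s) x) D) = E"
    using assms(7) notin by (auto simp: resolvent_def)
  ultimately show ?thesis using derivation.resolve[OF assms(1-3)] by metis
qed

section \<open>An invariant for resolution with clauses of length 2\<close>

lemma resolvable_sym: "resolvable x C D \<Longrightarrow> resolvable (compl_lit x) D C"
proof -
  assume x: "resolvable x C D"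
  have "l = compl_lit x" if "l \<in> D" "compl_lit l \<in> C" for l
    using x that unfolding resolvable_def
    by (metis (mono_tags, lifting) compl_compl mem_Collect_eq singletonD)
  moreover have "x \<in> C" "compl_lit x \<in> D" using x unfolding resolvable_def by blast+
  moreover have "compl_lit (compl_lit x) = x" by simp
  ultimately have "l \<in> D \<and> compl_lit l \<in> C \<longleftrightarrow> l = compl_lit x" for l by metis
  then show ?thesis unfolding resolvable_def by simp
qed

lemma resolvent_sym: "resolvent (compl_lit x) D C = resolvent x C D"
  by (auto simp: resolvent_def)

text \<open>Exactly one of the two literals is true under \<open>f\<close>, so the clause holds
  under \<open>f\<close> and also under the complementary assignment. Unit clauses lack this
  property.\<close>

definition tight_pair :: "'a set \<Rightarrow> ('a \<Rightarrow> bool) \<Rightarrow> 'a clause \<Rightarrow> bool" where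
  "tight_pair W f C \<longleftrightarrow> (\<exists>a b s t. C = {lt s a, lt t b} \<and> a \<in> W \<and> b \<in> W \<and> a \<noteq> b \<and>
     (f a = s) \<noteq> (f b = t))"

text \<open>Only the literal on \<open>a\<close> may have its variable in \<open>W\<close>; hence it
  is the only one that a tight pair can resolve away.\<close>

definition loose_triple :: "'a set \<Rightarrow> 'a clause \<Rightarrow> bool" where
  "loose_triple W C \<longleftrightarrow> (\<exists>a b c p q r. C = {lt p a, lt q b, lt r c} \<and> b \<notin> W \<and> c \<notin> W \<and>
     a \<noteq> b \<and> a \<noteq> c \<and> b \<noteq> c)"

text \<open>The condition on the two literals is symmetric, so the clashing literal can be listed
  first.\<close>

lemma tight_pair_memE:
  assumes "tight_pair W f C" "x \<in> C"
  obtains a b s t where "C = {lt s a, lt t b}" "a \<in> W" "b \<in> W" "a \<noteq> b"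
    "(f a = s) \<noteq> (f b = t)" "x = lt s a"
proof -
  obtain a b s t where C: "C = {lt s a, lt t b}" "a \<in> W" "b \<in> W" "a \<noteq> b"
    "(f a = s) \<noteq> (f b = t)"
    using assms(1) unfolding tight_pair_def by blast
  show ?thesis
  proof (cases "x = lt s a")
    case True
    then show ?thesis using that C by blast
  next
    case False
    then have "x = lt t b" using assms(2) C by auto
    then show ?thesis using that[of t b s a] C by auto
  qed
qed

lemma tight_pair_resolve_pair:
  assumes "tight_pair W f C" "tight_pair W f D" "resolvable x C D"
  shows "tight_pair W f (resolvent x C D)"
proof -
  have clash: "\<And>l. l \<in> C \<Longrightarrow> compl_lit l \<in> D \<Longrightarrow> l = x" "x \<in> C" "compl_lit x \<in> D"
    using assms(3) unfolding resolvable_def by blast+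
  obtain a b s t where C: "C = {lt s a, lt t b}" "a \<in> W" "b \<in> W" "a \<noteq> b"
    "(f a = s) \<noteq> (f b = t)" "x = lt s a"
    by (rule tight_pair_memE[OF assms(1) clash(2)])
  obtain c u where D: "D = {lt (\<not> s) a, lt u c}" "c \<in> W" "a \<noteq> c"
    "(f a = (\<not> s)) \<noteq> (f c = u)"
    by (rule tight_pair_memE[OF assms(2) clash(3)]) (use C(6) in auto)
  \<comment> \<open>The literals on \<open>b\<close> and \<open>c\<close> have opposite truth values
    under \<open>f\<close>, because the clashing literals do. If the variables coincided, the
    literals would be complementary and give a second clash.\<close>
  have "b \<noteq> c"
  proof
    assume "b = c"
    then have "u = (\<not> t)" using C(5) D(4) by auto
    then show False using clash(1)[of "lt t b"] C D \<open>b = c\<close> by auto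
  qed
  moreover have "resolvent x C D = {lt t b, lt u c}"
    using C D by (auto simp: resolvent_def)
  moreover have "(f b = t) \<noteq> (f c = u)" using C(5) D(4) by auto
  ultimately show ?thesis using C D unfolding tight_pair_def by blast
qed

text \<open>The clashing variable is in \<open>W\<close>, so it is the first variable of the triple.
  It is replaced by another variable of \<open>W\<close>, which differs from the two outside
  \<open>W\<close>, and the length remains 3.\<close>

lemma tight_pair_resolve_triple:
  assumes "tight_pair W f C" "loose_triple W D" "resolvable x C D"
  shows "loose_triple W (resolvent x C D)"
proof -
  have clash: "x \<in> C" "compl_lit x \<in> D"
    using assms(3) unfolding resolvable_def by blast+
  obtain a b s t where C: "C = {lt s a, lt t b}" "a \<in> W" "b \<in> W" "a \<noteq> b" "x = lt s a"
    by (rule tight_pair_memE[OF assms(1) clash(1)])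
  obtain d c e p q r where D0: "D = {lt p d, lt q c, lt r e}" "c \<notin> W" "e \<notin> W"
     "d \<noteq> c" "d \<noteq> e" "c \<noteq> e"
    using assms(2) unfolding loose_triple_def by blast
  then have D: "d = a" "p = (\<not> s)" using clash(2) C by auto
  have "resolvent x C D = {lt t b, lt q c, lt r e}"
    using C D D0 by (auto simp: resolvent_def)
  moreover have "b \<noteq> c" "b \<noteq> e" using C D0 by auto
  ultimately show ?thesis using D0 unfolding loose_triple_def by metis
qed

text \<open>With \<open>k = 2\<close> a resolution step has a parent of length 2, i.e. an equivalence between
  two literals over \<open>W\<close>; all it can do is to replace a literal by an equivalent one.\<close>

lemma whd_derivable_2_invariant:
  assumes "whd_derivable 2 F C" "\<forall>C\<in>F. tight_pair W f C \<or> loose_triple W C"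
  shows "tight_pair W f C \<or> loose_triple W C"
  using assms
proof (induction rule: whd_derivable.induct)
  case (whd_resolve C D x)
  have card3: "card E = 3" if "loose_triple W E" for E
    using that unfolding loose_triple_def by auto
  have "tight_pair W f C \<or> tight_pair W f D"
    using whd_resolve card3[of C] card3[of D] by auto
  then show ?case
  proof
    assume "tight_pair W f C"
    then show ?thesis
      using whd_resolve tight_pair_resolve_pair tight_pair_resolve_triple by metis
  next
    assume "tight_pair W f D"
    then show ?thesis
      using whd_resolve tight_pair_resolve_pair tight_pair_resolve_triple
        resolvable_sym[OF whd_resolve.hyps(3)] resolvent_sym by metis
  qed
qed auto

lemma not_whd_derivable_2_empty:
  assumes "\<forall>C\<in>F. tight_pair W f C \<or> loose_triple W C"
  shows "\<not> whd_derivable 2 F {}"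
  using whd_derivable_2_invariant[OF _ assms, of "{}"]
  by (auto simp: tight_pair_def loose_triple_def)

section \<open>Building blocks of the refutation\<close>

lemma derivation_base:
  assumes der: "derivation F S" and dist: "distinct [a, w, c, d]"
    and c: "xor3 a w c \<subseteq> S" and d: "xor3 a w d \<subseteq> S"
  shows "derivation F ({{lt s c, lt (\<not> s) d}, {lt False a, lt s c, lt (\<not> s) d},
     {lt True a, lt s c, lt (\<not> s) d}} \<union> S)"
proof -
  have c': "{lt p a, lt q w, lt (p \<noteq> q) c} \<in> S" for p q using c by (auto simp: xor3_def)
  have d': "{lt p a, lt q w, lt (p \<noteq> q) d} \<in> S" for p q using d by (auto simp: xor3_def)
  \<comment> \<open>For a fixed sign \<open>p\<close> of \<open>a\<close>, the constraints for
    \<open>c\<close> and \<open>d\<close> are resolved on \<open>w\<close>. The two clauses obtained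
    in this way are then merged on \<open>a\<close>.\<close>
  have 1: "derivation F (insert {lt p a, lt s c, lt (\<not> s) d} S')"
    if "derivation F S'" "S \<subseteq> S'" for p S'
  proof -
    have "{lt p a, lt (p \<noteq> s) w, lt s c} \<in> S"
      using c'[of p "p \<noteq> s"] by (cases p; cases s; simp)
    moreover have "{lt p a, lt (p = s) w, lt (\<not> s) d} \<in> S"
      using d'[of p "p = s"] by (cases p; cases s; simp)
    ultimately show ?thesis
      using that(2) dist
      by (intro derivation_resolve_on[OF that(1), of "p \<noteq> s" w "{lt p a, lt s c}" "{lt p a, lt (\<not> s) d}"])
         (auto simp: insert_commute)
  qed
  have 2: "derivation F (insert {lt False a, lt s c, lt (\<not> s) d} (insert {lt True a, lt s c, lt (\<not> s) d} S))"
    by (rule 1[OF 1[OF der, of True], of False]) auto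
  have "derivation F (insert {lt s c, lt (\<not> s) d} (insert {lt False a, lt s c, lt (\<not> s) d}
      (insert {lt True a, lt s c, lt (\<not> s) d} S)))"
    using dist
    by (intro derivation_resolve_on[OF 2, of False a "{lt s c, lt (\<not> s) d}" "{lt s c, lt (\<not> s) d}"]) auto
  then show ?thesis by simp
qed

text \<open>For each sign of \<open>w\<close>, the equivalence of \<open>a\<close> and
  \<open>b\<close> first renames \<open>b\<close> to \<open>a\<close> in the clause for
  \<open>d\<close>; the result is resolved on \<open>a\<close> with the clause for \<open>c\<close>.
  Merging the two outcomes on \<open>w\<close> gives the fifth clause. The renaming is what keeps
  the length at 3.\<close>

lemma derivation_step:
  assumes der: "derivation F S" and dist: "distinct [a, b, w, c, d]"
    and ab: "xor2 False a b \<subseteq> S" and c: "xor3 a w c \<subseteq> S" and d: "xor3 b w d \<subseteq> S"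
  shows "derivation F ({{lt s c, lt (\<not> s) d},
     {lt False w, lt s c, lt (\<not> s) d}, {lt (\<not> s) a, lt False w, lt (\<not> s) d},
     {lt True w, lt s c, lt (\<not> s) d}, {lt s a, lt True w, lt (\<not> s) d}} \<union> S)"
proof -
  have ab': "{lt p a, lt (\<not> p) b} \<in> S" for p using ab by (cases p) (auto simp: xor2_explicit)
  have c': "{lt p a, lt q w, lt (p \<noteq> q) c} \<in> S" for p q using c by (auto simp: xor3_def)
  have d': "{lt p b, lt q w, lt (p \<noteq> q) d} \<in> S" for p q using d by (auto simp: xor3_def)
  have 1: "derivation F (insert {lt q w, lt s c, lt (\<not> s) d} (insert {lt (q = s) a, lt q w, lt (\<not> s) d} S'))"
    if "derivation F S'" "S \<subseteq> S'" for q S'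
  proof -
    have c'': "{lt (q \<noteq> s) a, lt q w, lt s c} \<in> S"
      using c'[of "q \<noteq> s" q] by (cases q; cases s; simp)
    have d'': "{lt (q = s) b, lt q w, lt (\<not> s) d} \<in> S"
      using d'[of "q = s" q] by (cases q; cases s; simp)
    have *: "derivation F (insert {lt (q = s) a, lt q w, lt (\<not> s) d} S')"
      using ab'[of "q = s"] d'' that(2) dist
      by (intro derivation_resolve_on[OF that(1), of "q \<noteq> s" b "{lt (q = s) a}" "{lt q w, lt (\<not> s) d}"])
         (auto simp: insert_commute)
    show ?thesis
      using c'' that(2) dist
      by (intro derivation_resolve_on[OF *, of "q = s" a "{lt q w, lt (\<not> s) d}" "{lt q w, lt s c}"])
         (auto simp: insert_commute)
  qed
  have 2: "derivation F (insert {lt False w, lt s c, lt (\<not> s) d} (insert {lt (False = s) a, lt False w, lt (\<not> s) d}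
     (insert {lt True w, lt s c, lt (\<not> s) d} (insert {lt (True = s) a, lt True w, lt (\<not> s) d} S))))"
    by (rule 1[OF 1[OF der, of True], of False]) auto
  have "derivation F (insert {lt s c, lt (\<not> s) d} (insert {lt False w, lt s c, lt (\<not> s) d} (insert {lt (False = s) a, lt False w, lt (\<not> s) d}
     (insert {lt True w, lt s c, lt (\<not> s) d} (insert {lt (True = s) a, lt True w, lt (\<not> s) d} S)))))"
    using dist
    by (intro derivation_resolve_on[OF 2, of False w "{lt s c, lt (\<not> s) d}" "{lt s c, lt (\<not> s) d}"]) auto
  then show ?thesis by simp
qed

text \<open>Eliminating \<open>b\<close> between a = b and the inequality of \<open>b\<close> and
  \<open>w\<close> yields \<open>{lt p a, lt p w}\<close>. Resolving this on \<open>a\<close> with a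
  clause of a = w leaves the unit.\<close>

lemma derivation_final:
  assumes der: "derivation F S" and dist: "distinct [a, b, w]"
    and ab: "xor2 False a b \<subseteq> S" and aw: "xor2 False a w \<subseteq> S" and bw: "xor2 True b w \<subseteq> S"
  shows "derivation F ({{lt p w}, {lt (\<not> p) b, lt p w}, {lt p a, lt p w}} \<union> S)"
proof -
  have ab': "{lt p a, lt (\<not> p) b} \<in> S" for p using ab by (cases p) (auto simp: xor2_explicit)
  have aw': "{lt p a, lt (\<not> p) w} \<in> S" for p using aw by (cases p) (auto simp: xor2_explicit)
  have bw': "{lt p b, lt p w} \<in> S" for p using bw by (cases p) (auto simp: xor2_explicit)
  have 1: "derivation F (insert {lt p a, lt p w} S)"
    using ab'[of p] bw'[of p] dist
    by (intro derivation_resolve_on[OF der, of "\<not> p" b "{lt p a}" "{lt p w}"])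
       (auto simp: insert_commute)
  have 2: "derivation F (insert {lt (\<not> p) b, lt p w} (insert {lt p a, lt p w} S))"
    using ab'[of p] aw'[of "\<not> p"] dist
    by (intro derivation_resolve_on[OF 1, of p a "{lt (\<not> p) b}" "{lt p w}"]) auto
  have "derivation F (insert {lt p w} (insert {lt (\<not> p) b, lt p w} (insert {lt p a, lt p w} S)))"
    using aw'[of "\<not> p"] dist
    by (intro derivation_resolve_on[OF 2, of p a "{lt p w}" "{lt p w}"]) auto
  then show ?thesis by simp
qed

text \<open>This serves chains without a link, where both end constraints concern the same two
  variables.\<close>

lemma derivation_final_same:
  assumes der: "derivation F S" and dist: "a \<noteq> w"
    and eq: "xor2 False a w \<subseteq> S" and neq: "xor2 True a w \<subseteq> S"
  shows "derivation F (insert {lt p w} S)"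
proof -
  have "{lt p a, lt (\<not> p) w} \<in> S" for p using eq by (cases p) (auto simp: xor2_explicit)
  from this[of "\<not> p"] have eq': "{lt (\<not> p) a, lt p w} \<in> S" by simp
  have neq': "{lt p a, lt p w} \<in> S" using neq by (cases p) (auto simp: xor2_explicit)
  show ?thesis
    using eq' neq' dist
    by (intro derivation_resolve_on[OF der, of p a "{lt p w}" "{lt p w}"]) auto
qed

text \<open>The two signs contribute three clauses each. The conditions on variables will show that
  the clauses of \<open>N\<close> are new, and \<open>xor2 False c d\<close> is the input of the
  next stage.\<close>

lemma derivation_base_set:
  assumes der: "derivation F S" and dist: "distinct [a, w, c, d]"
    and c: "xor3 a w c \<subseteq> S" and d: "xor3 a w d \<subseteq> S"
  shows "\<exists>N. derivation F (N \<union> S) \<and> finite N \<and> card N = 6 \<and>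
    (\<forall>C\<in>N. clause_var C \<subseteq> {a, w, c, d} \<and> c \<in> clause_var C \<and> d \<in> clause_var C \<and> card C \<le> 3) \<and>
    xor2 False c d \<subseteq> N"
proof -
  let ?N = "\<lambda>s. {{lt s c, lt (\<not> s) d}, {lt False a, lt s c, lt (\<not> s) d},
     {lt True a, lt s c, lt (\<not> s) d}}"
  have "derivation F (?N False \<union> (?N True \<union> S))"
    by (intro derivation_base[OF derivation_base[OF assms] dist] le_supI2 c d)
  moreover have "card (?N False \<union> ?N True) = 6" using dist by (simp add: set_eq_subset)
  moreover have "\<forall>C\<in>?N False \<union> ?N True. clause_var C \<subseteq> {a, w, c, d} \<and> c \<in> clause_var C \<and>
      d \<in> clause_var C \<and> card C \<le> 3"
    using dist by simp
  ultimately show ?thesis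
    by (intro exI[of _ "?N False \<union> ?N True"]) (simp add: Un_assoc xor2_explicit)
qed

text \<open>The two signs contribute five clauses each. With a, c from one chain and b, d from the
  other, each new clause mixes the chains, and \<open>d\<close> separates it from everything derived
  before.\<close>

lemma derivation_step_set:
  assumes der: "derivation F S" and dist: "distinct [a, b, w, c, d]"
    and ab: "xor2 False a b \<subseteq> S" and c: "xor3 a w c \<subseteq> S" and d: "xor3 b w d \<subseteq> S"
  shows "\<exists>N. derivation F (N \<union> S) \<and> finite N \<and> card N = 10 \<and>
    (\<forall>C\<in>N. clause_var C \<subseteq> {a, b, w, c, d} \<and> d \<in> clause_var C \<and>
       (a \<in> clause_var C \<or> c \<in> clause_var C) \<and> card C \<le> 3) \<and>
    xor2 False c d \<subseteq> N"
proof -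
  let ?N = "\<lambda>s. {{lt s c, lt (\<not> s) d},
     {lt False w, lt s c, lt (\<not> s) d}, {lt (\<not> s) a, lt False w, lt (\<not> s) d},
     {lt True w, lt s c, lt (\<not> s) d}, {lt s a, lt True w, lt (\<not> s) d}}"
  have "derivation F (?N False \<union> (?N True \<union> S))"
    by (intro derivation_step[OF derivation_step[OF assms] dist] le_supI2 ab c d)
  moreover have "card (?N False \<union> ?N True) = 10" using dist by (simp add: set_eq_subset)
  moreover have "\<forall>C\<in>?N False \<union> ?N True. clause_var C \<subseteq> {a, b, w, c, d} \<and> d \<in> clause_var C \<and>
      (a \<in> clause_var C \<or> c \<in> clause_var C) \<and> card C \<le> 3"
    using dist by simp
  ultimately show ?thesis
    by (intro exI[of _ "?N False \<union> ?N True"]) (simp add: Un_assoc xor2_explicit)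
qed

text \<open>The clauses \<open>{lt (\<not> p) b, lt p w}\<close> are not needed for deriving the units; they are included
  because the refutation is to have exactly \<open>18n - 29\<close> clauses.\<close>

lemma derivation_final_set:
  assumes der: "derivation F S" and dist: "distinct [a, b, w]"
    and ab: "xor2 False a b \<subseteq> S" and aw: "xor2 False a w \<subseteq> S" and bw: "xor2 True b w \<subseteq> S"
  shows "\<exists>N. derivation F (N \<union> S) \<and> finite N \<and> card N = 6 \<and>
    (\<forall>C\<in>N. w \<in> clause_var C \<and> card C \<le> 3) \<and>
    N \<inter> (xor2 False a w \<union> xor2 True b w) = {} \<and> {lt True w} \<in> N \<and> {lt False w} \<in> N"
proof -
  let ?N = "\<lambda>p. {{lt p w}, {lt (\<not> p) b, lt p w}, {lt p a, lt p w}}"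
  have "derivation F (?N False \<union> (?N True \<union> S))"
    by (intro derivation_final[OF derivation_final[OF assms] dist] le_supI2 ab aw bw)
  moreover have "card (?N False \<union> ?N True) = 6" using dist by (simp add: set_eq_subset)
  moreover have "\<forall>C\<in>?N False \<union> ?N True. w \<in> clause_var C \<and> card C \<le> 3"
    using dist by simp
  moreover have "(?N False \<union> ?N True) \<inter> (xor2 False a w \<union> xor2 True b w) = {}"
    using dist by (simp add: xor2_explicit set_eq_subset)
  ultimately show ?thesis
    by (intro exI[of _ "?N False \<union> ?N True"]) (simp add: Un_assoc)
qed

section \<open>The split chains\<close>

text \<open>Here \<open>m = n - 1\<close>, and the variable \<open>v\<^sub>1\<close> serves as \<open>y\<^sub>1\<close> in both chains, so that
  the first XOR-clause of a splitting has the same shape as the others.\<close>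

locale split_chains =
  fixes v Y Z :: "nat \<Rightarrow> 'a" and m :: nat
  assumes m: "0 < m"
    and inj_v: "inj_on v {1..Suc m}" and inj_Y: "inj_on Y {1..m}" and inj_Z: "inj_on Z {1..m}"
    and Y1: "Y 1 = v 1" and Z1: "Z 1 = v 1"
    and Yv': "\<And>i j. 2 \<le> i \<Longrightarrow> i \<le> m \<Longrightarrow> 1 \<le> j \<Longrightarrow> j \<le> Suc m \<Longrightarrow> Y i \<noteq> v j"
    and Zv': "\<And>i j. 2 \<le> i \<Longrightarrow> i \<le> m \<Longrightarrow> 1 \<le> j \<Longrightarrow> j \<le> Suc m \<Longrightarrow> Z i \<noteq> v j"
    and YZ': "\<And>i j. 2 \<le> i \<Longrightarrow> i \<le> m \<Longrightarrow> 2 \<le> j \<Longrightarrow> j \<le> m \<Longrightarrow> Y i \<noteq> Z j"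
begin

section \<open>Distinctness of the variables\<close>

lemma v_eq_iff [simp]: "0 < i \<Longrightarrow> i \<le> Suc m \<Longrightarrow> 0 < j \<Longrightarrow> j \<le> Suc m \<Longrightarrow> v i = v j \<longleftrightarrow> i = j"
  using inj_v by (auto dest: inj_onD)

lemma Y_eq_iff [simp]: "0 < i \<Longrightarrow> i \<le> m \<Longrightarrow> 0 < j \<Longrightarrow> j \<le> m \<Longrightarrow> Y i = Y j \<longleftrightarrow> i = j"
  using inj_Y by (auto dest: inj_onD)

lemma Z_eq_iff [simp]: "0 < i \<Longrightarrow> i \<le> m \<Longrightarrow> 0 < j \<Longrightarrow> j \<le> m \<Longrightarrow> Z i = Z j \<longleftrightarrow> i = j"
  using inj_Z by (auto dest: inj_onD)

lemma Y_neq_v [simp]: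
  assumes "0 < i" "i \<le> m" "1 < j" "j \<le> Suc m"
  shows "Y i \<noteq> v j" "v j \<noteq> Y i"
proof -
  show "Y i \<noteq> v j"
  proof (cases "i = 1")
    case True
    then show ?thesis using assms v_eq_iff[of 1 j] Y1 by simp
  next
    case False
    then show ?thesis using assms Yv'[of i j] by simp
  qed
  then show "v j \<noteq> Y i" by metis
qed

lemma Z_neq_v [simp]:
  assumes "0 < i" "i \<le> m" "1 < j" "j \<le> Suc m"
  shows "Z i \<noteq> v j" "v j \<noteq> Z i"
proof -
  show "Z i \<noteq> v j"
  proof (cases "i = 1")
    case True
    then show ?thesis using assms v_eq_iff[of 1 j] Z1 by simp
  next
    case False
    then show ?thesis using assms Zv'[of i j] by simp
  qed
  then show "v j \<noteq> Z i" by metis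
qed

lemma Y_eq_Z_iff [simp]:
  assumes "0 < i" "i \<le> m" "0 < j" "j \<le> m"
  shows "Y i = Z j \<longleftrightarrow> i = 1 \<and> j = 1" "Z j = Y i \<longleftrightarrow> i = 1 \<and> j = 1"
proof -
  show "Y i = Z j \<longleftrightarrow> i = 1 \<and> j = 1"
  proof -
    consider "i = 1" | "j = 1" | "i \<noteq> 1" "j \<noteq> 1" by blast
    then show ?thesis
    proof cases
      case 1
      then have "Y i = Z 1" using Y1 Z1 by simp
      then show ?thesis using 1 assms Z_eq_iff[of 1 j] by auto
    next
      case 2
      then have "Z j = Y 1" using Y1 Z1 by simp
      then show ?thesis using 2 assms Y_eq_iff[of i 1] by simp
    next
      case 3
      then show ?thesis using assms YZ'[of i j] by simp
    qed
  qed
  then show "Z j = Y i \<longleftrightarrow> i = 1 \<and> j = 1" by metis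
qed

text \<open>Link i expresses that passing from i to i + 1 adds v_(i+1) modulo 2 in both chains.
  Under all links, \<open>Y i\<close> and \<open>Z i\<close> thus both equal the parity of v_1, ...,
  v_i.\<close>

definition link :: "nat \<Rightarrow> 'a clause_set" where
  "link i = xor3 (Y i) (v (Suc i)) (Y (Suc i)) \<union> xor3 (Z i) (v (Suc i)) (Z (Suc i))"

definition links :: "'a clause_set" where
  "links = (\<Union>i\<in>{1..<m}. link i)"

text \<open>The signs differ because the last literal is positive in the first XOR-clause and
  complemented in the second.\<close>

definition ends :: "'a clause_set" where
  "ends = xor2 False (Y m) (v (Suc m)) \<union> xor2 True (Z m) (v (Suc m))"

definition chains :: "'a clause_set" where
  "chains = links \<union> ends"

section \<open>Variables, lengths and numbers of the clauses in the chains\<close>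

lemma clause_var_link:
  assumes "C \<in> link i"
  shows "clause_var C = {Y i, v (Suc i), Y (Suc i)} \<or> clause_var C = {Z i, v (Suc i), Z (Suc i)}"
  using assms clause_var_xor3 unfolding link_def by (metis UnE)

lemma clause_var_ends:
  assumes "C \<in> ends"
  shows "clause_var C = {Y m, v (Suc m)} \<or> clause_var C = {Z m, v (Suc m)}"
  using assms clause_var_xor2 unfolding ends_def by (metis UnE)

lemma card_in_link:
  assumes "C \<in> link i" "i \<in> {1..<m}"
  shows "card C = 3"
  using assms unfolding link_def by (auto intro!: card_in_xor3)

lemma card_in_ends:
  assumes "C \<in> ends"
  shows "card C = 2"
  using assms m unfolding ends_def by (auto dest!: card_in_xor2)

lemma card_link:
  assumes "i \<in> {1..<m}"
  shows "card (link i) = 8"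
proof -
  have "xor3 (Y i) (v (Suc i)) (Y (Suc i)) \<inter> xor3 (Z i) (v (Suc i)) (Z (Suc i)) = {}"
  proof (rule ccontr)
    assume "\<not> ?thesis"
    then obtain C where "C \<in> xor3 (Y i) (v (Suc i)) (Y (Suc i))"
      "C \<in> xor3 (Z i) (v (Suc i)) (Z (Suc i))" by blast
    \<comment> \<open>A common clause would force equal variable sets, but \<open>Y (Suc i)\<close>
      has index at least 2 and so belongs to the first chain alone.\<close>
    then have "{Y i, v (Suc i), Y (Suc i)} = {Z i, v (Suc i), Z (Suc i)}"
      using clause_var_xor3 by metis
    then have "Y (Suc i) \<in> {Z i, v (Suc i), Z (Suc i)}" by blast
    then show False using assms by simp
  qed
  then show ?thesis using assms unfolding link_def by (simp add: card_Un_disjoint card_xor3)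
qed

lemma finite_link [simp]: "finite (link i)"
  by (simp add: link_def)

text \<open>The variable \<open>v (Suc i)\<close> identifies the link: it occurs in every clause of
  link i and in no other link.\<close>

lemma link_disjoint:
  assumes "i \<in> {1..<m}" "j \<in> {1..<m}" "i \<noteq> j"
  shows "link i \<inter> link j = {}"
proof (rule ccontr)
  assume "\<not> ?thesis"
  then obtain C where C: "C \<in> link i" "C \<in> link j" by blast
  have "v (Suc i) \<in> clause_var C" using clause_var_link[OF C(1)] by auto
  then show False using clause_var_link[OF C(2)] assms by auto
qed

lemma card_links: "card links = 8 * (m - 1)"
proof -
  have "card links = (\<Sum>i\<in>{1..<m}. card (link i))"
    unfolding links_def using link_disjoint by (intro card_UN_disjoint) auto
  also have "\<dots> = 8 * (m - 1)" using card_link by simp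
  finally show ?thesis .
qed

lemma card_ends: "card ends = 4"
proof -
  have "Y m \<noteq> v (Suc m)" "Z m \<noteq> v (Suc m)" using m by simp_all
  moreover from this have "xor2 False (Y m) (v (Suc m)) \<inter> xor2 True (Z m) (v (Suc m)) = {}"
    by (auto simp: xor2_explicit doubleton_eq_iff)
  ultimately show ?thesis by (simp add: ends_def card_Un_disjoint card_xor2)
qed

lemma finite_links [simp]: "finite links" "finite ends"
  by (auto simp: links_def ends_def)

lemma links_ends_disjoint: "links \<inter> ends = {}"
  using card_in_link card_in_ends unfolding links_def by fastforce

lemma finite_chains [simp]: "finite chains"
  by (simp add: chains_def)

lemma card_chains: "card chains = 8 * (m - 1) + 4"
  using links_ends_disjoint by (simp add: chains_def card_Un_disjoint card_links card_ends)

lemma card_le_in_chains: "C \<in> chains \<Longrightarrow> card C \<le> 3"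
  using card_in_link card_in_ends unfolding chains_def links_def by fastforce

lemma empty_notin_chains: "{} \<notin> chains"
  using card_in_link card_in_ends unfolding chains_def links_def by fastforce

lemma num_lits_chains: "num_lits chains = 24 * (m - 1) + 8"
proof -
  have "num_lits chains = (\<Sum>C\<in>links. card C) + (\<Sum>C\<in>ends. card C)"
    using links_ends_disjoint by (simp add: num_lits_def chains_def sum.union_disjoint)
  also have "(\<Sum>C\<in>links. card C) = (\<Sum>C\<in>links. 3)"
    using card_in_link by (intro sum.cong) (auto simp: links_def)
  also have "(\<Sum>C\<in>ends. card C) = (\<Sum>C\<in>ends. 2)"
    using card_in_ends by (intro sum.cong) auto
  finally show ?thesis by (simp add: card_links card_ends)
qed

lemma var_chains: "var chains = v ` {1..Suc m} \<union> (Y ` {2..m} \<union> Z ` {2..m})"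
proof -
  have "var chains = (\<Union>i\<in>{1..<m}. {Y i, v (Suc i), Y (Suc i)} \<union> {Z i, v (Suc i), Z (Suc i)})
      \<union> {Y m, v (Suc m), Z m}"
    by (auto simp: chains_def links_def ends_def link_def)
  also have "\<dots> = v ` Suc ` {1..<m} \<union> {v (Suc m)} \<union> (Y ` {1..<m} \<union> {Y m} \<union> Y ` Suc ` {1..<m})
      \<union> (Z ` {1..<m} \<union> {Z m} \<union> Z ` Suc ` {1..<m})"
    by blast
  also have "Y ` {1..<m} \<union> {Y m} \<union> Y ` Suc ` {1..<m} = insert (v 1) (Y ` {2..m})"
  proof -
    have "{1..<m} \<union> {m} \<union> Suc ` {1..<m} = insert 1 {2..m}" using m by auto
    then show ?thesis using Y1 by (metis image_Un image_empty image_insert)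
  qed
  also have "Z ` {1..<m} \<union> {Z m} \<union> Z ` Suc ` {1..<m} = insert (v 1) (Z ` {2..m})"
  proof -
    have "{1..<m} \<union> {m} \<union> Suc ` {1..<m} = insert 1 {2..m}" using m by auto
    then show ?thesis using Z1 by (metis image_Un image_empty image_insert)
  qed
  also have "v ` Suc ` {1..<m} \<union> {v (Suc m)} \<union> insert (v 1) (Y ` {2..m}) \<union> insert (v 1) (Z ` {2..m})
      = v ` (insert 1 (Suc ` {1..<m} \<union> {Suc m})) \<union> (Y ` {2..m} \<union> Z ` {2..m})"
    by blast
  also have "insert 1 (Suc ` {1..<m} \<union> {Suc m}) = {1..Suc m}" using m by auto
  finally show ?thesis .
qed

lemma num_vars_chains: "num_vars chains = Suc m + 2 * (m - 1)"
proof -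
  have Y: "card (Y ` {2..m}) = m - 1" using inj_Y
    by (subst card_image) (auto intro: inj_on_subset)
  have Z: "card (Z ` {2..m}) = m - 1" using inj_Z
    by (subst card_image) (auto intro: inj_on_subset)
  have "Y ` {2..m} \<inter> Z ` {2..m} = {}" by auto
  then have YZ: "card (Y ` {2..m} \<union> Z ` {2..m}) = 2 * (m - 1)"
    using Y Z by (simp add: card_Un_disjoint)
  have "v ` {1..Suc m} \<inter> (Y ` {2..m} \<union> Z ` {2..m}) = {}"
    using Yv' Zv' by fastforce
  then show ?thesis
    using YZ inj_v by (simp add: num_vars_def var_chains card_Un_disjoint card_image)
qed

section \<open>Locating clauses by their variables, and the lower bound\<close>

lemma xor_subset_chains:
  assumes "0 < i" "i < m"
  shows "xor3 (Y i) (v (Suc i)) (Y (Suc i)) \<subseteq> chains"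
    "xor3 (Z i) (v (Suc i)) (Z (Suc i)) \<subseteq> chains"
  using assms unfolding chains_def links_def link_def by fastforce+

lemma ends_subset_chains:
  "xor2 False (Y m) (v (Suc m)) \<subseteq> chains" "xor2 True (Z m) (v (Suc m)) \<subseteq> chains"
  by (auto simp: chains_def ends_def)

text \<open>Each axiom comes from a single chain, and indices above 1 exclude the shared first
  variable. Derived clauses that mix the chains are therefore never axioms.\<close>

lemma no_mixed_clause_in_chains:
  assumes "C \<in> chains" "1 < i" "i \<le> m" "1 < j" "j \<le> m" "Y i \<in> clause_var C" "Z j \<in> clause_var C"
  shows False
proof -
  from assms(1) consider k where "k \<in> {1..<m}" "C \<in> link k" | "C \<in> ends"
    by (auto simp: chains_def links_def)
  then show False
  proof cases
    case 1
    then show False using clause_var_link[OF 1(2)] assms by auto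
  next
    case 2
    then show False using clause_var_ends[OF 2] assms by auto
  qed
qed

lemma last_variable_in_chains:
  assumes "C \<in> chains" "v (Suc m) \<in> clause_var C"
  shows "C \<in> ends"
proof (rule ccontr)
  assume "C \<notin> ends"
  with assms(1) obtain k where k: "k \<in> {1..<m}" "C \<in> link k"
    by (auto simp: chains_def links_def)
  then show False using clause_var_link[OF k(2)] assms by auto
qed

lemma not_whd_derivable_2_chains:
  assumes "1 < m"
  shows "\<not> whd_derivable 2 chains {}"
proof -
  \<comment> \<open>\<open>W\<close> consists of the variables of the end constraints, and
    \<open>f\<close> satisfies these constraints. The assumption on \<open>m\<close> makes
    \<open>Y m\<close> and \<open>Z m\<close> different, so \<open>f\<close> can separate
    them.\<close>
  define W where "W = {Y m, Z m, v (Suc m)}"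
  define f where "f x = (x \<noteq> Z m)" for x
  have f: "f (Y m)" "f (v (Suc m))" "\<not> f (Z m)" using assms by (auto simp: f_def)
  have W: "Y m \<in> W" "Z m \<in> W" "v (Suc m) \<in> W" by (auto simp: W_def)
  have tight: "tight_pair W f C" if "C \<in> ends" for C
  proof -
    have ne: "Y m \<noteq> v (Suc m)" "Z m \<noteq> v (Suc m)" using assms by auto
    from that consider p where "C = {lt p (Y m), lt (\<not> p) (v (Suc m))}"
      | p where "C = {lt p (Z m), lt p (v (Suc m))}"
      by (auto simp: ends_def xor2_def)
    then show ?thesis
    proof cases
      case (1 p)
      moreover have "(f (Y m) = p) \<noteq> (f (v (Suc m)) = (\<not> p))" using f by simp
      ultimately show ?thesis using W ne unfolding tight_pair_def by blast
    next
      case (2 p)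
      moreover have "(f (Z m) = p) \<noteq> (f (v (Suc m)) = p)" using f by simp
      ultimately show ?thesis using W ne unfolding tight_pair_def by blast
    qed
  qed
  have triple: "loose_triple W C" if C: "C \<in> xor3 a b c" and "a \<notin> W" "b \<notin> W" "a \<noteq> b" "a \<noteq> c" "b \<noteq> c"
    for C a b c
  proof -
    obtain p q where "C = {lt p a, lt q b, lt (p \<noteq> q) c}"
      using C by (auto simp: xor3_def)
    \<comment> \<open>The third variable of a link lies in \<open>W\<close> when the link is the
      last one, so its literal is moved to the front, where \<open>loose_triple\<close> admits
      it.\<close>
    then have "C = {lt (p \<noteq> q) c, lt p a, lt q b}" by blast
    then show ?thesis using that(2-) unfolding loose_triple_def by metis
  qed
  have "loose_triple W C" if i: "i \<in> {1..<m}" and "C \<in> link i" for C i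
  proof -
    have "Y i \<notin> W" "Z i \<notin> W" "v (Suc i) \<notin> W" using i assms by (auto simp: W_def)
    then show ?thesis using that by (auto simp: link_def intro: triple)
  qed
  then have "\<forall>C\<in>chains. tight_pair W f C \<or> loose_triple W C"
    using tight unfolding chains_def links_def by blast
  then show ?thesis by (rule not_whd_derivable_2_empty)
qed


text \<open>The count is 8 * (m - 1) + 4 axioms, 6 clauses for k = 2 and 10 for each further index.
  The bound on the variables of derived clauses is part of the induction because it shows that the
  next stage adds only new clauses.\<close>

lemma derivation_up_to:
  assumes "1 < k" "k \<le> m"
  shows "\<exists>S. derivation chains S \<and> chains \<subseteq> S \<and> card S = 8 * (m - 1) + 10 * (k - 1) \<and>
    (\<forall>C\<in>S. card C \<le> 3 \<and> C \<noteq> {}) \<and> xor2 False (Y k) (Z k) \<subseteq> S \<and>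
    (\<forall>C\<in>S - chains. clause_var C \<subseteq> v ` {1..k} \<union> Y ` {1..k} \<union> Z ` {1..k})"
proof -
  \<comment> \<open>The induction starts at 2, since \<open>Y 1\<close> and \<open>Z 1\<close> are
    the same variable.\<close>
  have "Suc 1 \<le> k" using assms by simp
  then show ?thesis using assms(2)
  proof (induction k rule: dec_induct)
    case base
    have d: "distinct [v 1, v 2, Y 2, Z 2]" using base Y1 Y_eq_iff[of 1 2] Z1 Z_eq_iff[of 1 2] by simp
    have sub: "xor3 (v 1) (v 2) (Y 2) \<subseteq> chains" "xor3 (v 1) (v 2) (Z 2) \<subseteq> chains"
      using xor_subset_chains[of 1] base Y1 Z1 by (simp_all add: numeral_2_eq_2)
    have "derivation chains chains" by (simp add: derivation_axioms)
    from derivation_base_set[OF this d sub] obtain N where N: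
      "derivation chains (N \<union> chains)" "finite N" "card N = 6"
      "\<forall>C\<in>N. clause_var C \<subseteq> {v 1, v 2, Y 2, Z 2} \<and> Y 2 \<in> clause_var C \<and>
         Z 2 \<in> clause_var C \<and> card C \<le> 3"
      "xor2 False (Y 2) (Z 2) \<subseteq> N" by blast
    have "N \<inter> chains = {}" using N(4) no_mixed_clause_in_chains[of _ 2 2] base by auto
    then have "card (N \<union> chains) = 8 * (m - 1) + 10 * (Suc 1 - 1)"
      using N by (simp add: card_Un_disjoint card_chains)
    moreover have "\<forall>C\<in>N \<union> chains. card C \<le> 3 \<and> C \<noteq> {}"
      using N(4) card_le_in_chains empty_notin_chains by auto
    moreover have "\<forall>C\<in>(N \<union> chains) - chains.
        clause_var C \<subseteq> v ` {1..Suc 1} \<union> Y ` {1..Suc 1} \<union> Z ` {1..Suc 1}"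
    proof
      fix C assume "C \<in> (N \<union> chains) - chains"
      then have "clause_var C \<subseteq> {v 1, v 2, Y 2, Z 2}" using N(4) by (metis DiffE UnE)
      also have "\<dots> \<subseteq> v ` {1..Suc 1} \<union> Y ` {1..Suc 1} \<union> Z ` {1..Suc 1}" by auto
      finally show "clause_var C \<subseteq> v ` {1..Suc 1} \<union> Y ` {1..Suc 1} \<union> Z ` {1..Suc 1}" .
    qed
    moreover have "xor2 False (Y (Suc 1)) (Z (Suc 1)) \<subseteq> N \<union> chains"
      using N(5) by (auto simp: numeral_2_eq_2)
    ultimately show ?case using N(1)
      by (intro exI[of _ "N \<union> chains"]) simp
  next
    case (step k)
    then obtain S where S: "derivation chains S" "chains \<subseteq> S"
      "card S = 8 * (m - 1) + 10 * (k - 1)" "\<forall>C\<in>S. card C \<le> 3 \<and> C \<noteq> {}"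
      "xor2 False (Y k) (Z k) \<subseteq> S"
      "\<forall>C\<in>S - chains. clause_var C \<subseteq> v ` {1..k} \<union> Y ` {1..k} \<union> Z ` {1..k}" by auto
    have k: "1 < k" "k < m" using step by auto
    have d: "distinct [Y k, Z k, v (Suc k), Y (Suc k), Z (Suc k)]" using k by simp
    have sub: "xor3 (Y k) (v (Suc k)) (Y (Suc k)) \<subseteq> S" "xor3 (Z k) (v (Suc k)) (Z (Suc k)) \<subseteq> S"
      using xor_subset_chains[of k] k S(2) by auto
    from derivation_step_set[OF S(1) d S(5) sub] obtain N where N:
      "derivation chains (N \<union> S)" "finite N" "card N = 10"
      "\<forall>C\<in>N. clause_var C \<subseteq> {Y k, Z k, v (Suc k), Y (Suc k), Z (Suc k)} \<and> Z (Suc k) \<in> clause_var C \<and>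
         (Y k \<in> clause_var C \<or> Y (Suc k) \<in> clause_var C) \<and> card C \<le> 3"
      "xor2 False (Y (Suc k)) (Z (Suc k)) \<subseteq> N" by blast
    \<comment> \<open>Each clause of \<open>N\<close> contains \<open>Z (Suc k)\<close> together
      with \<open>Y k\<close> or \<open>Y (Suc k)\<close>. All these indices exceed 1, so the clause
      mixes the chains.\<close>
    have "N \<inter> chains = {}"
      using N(4) no_mixed_clause_in_chains[of _ k "Suc k"]
        no_mixed_clause_in_chains[of _ "Suc k" "Suc k"] k by auto
    moreover have "Z (Suc k) \<noteq> v j" if "j \<in> {1..k}" for j
      using k that Zv'[of "Suc k" j] by simp
    then have "Z (Suc k) \<notin> v ` {1..k}" by blast
    then have "Z (Suc k) \<notin> v ` {1..k} \<union> Y ` {1..k} \<union> Z ` {1..k}" using k by auto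
    \<comment> \<open>Clauses derived earlier only use indices up to \<open>k\<close>, whereas all
      clauses of \<open>N\<close> contain \<open>Z (Suc k)\<close>.\<close>
    then have "N \<inter> (S - chains) = {}" using N(4) S(6) by blast
    ultimately have disj: "N \<inter> S = {}" by blast
    then have "card (N \<union> S) = 8 * (m - 1) + 10 * (Suc k - 1)"
      using N S(3) k derivation_finite[OF S(1)] by (simp add: card_Un_disjoint)
    moreover have "\<forall>C\<in>N \<union> S. card C \<le> 3 \<and> C \<noteq> {}" using N(4) S(4) by auto
    moreover have "clause_var C \<subseteq> v ` {1..Suc k} \<union> Y ` {1..Suc k} \<union> Z ` {1..Suc k}"
      if "C \<in> (N \<union> S) - chains" for C
    proof (cases "C \<in> N")
      case True
      have "{Y k, Z k, v (Suc k), Y (Suc k), Z (Suc k)}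
          \<subseteq> v ` {1..Suc k} \<union> Y ` {1..Suc k} \<union> Z ` {1..Suc k}" using k by auto
      moreover have "clause_var C \<subseteq> {Y k, Z k, v (Suc k), Y (Suc k), Z (Suc k)}"
        using N(4) True by simp
      ultimately show ?thesis by (rule subset_trans[rotated])
    next
      case False
      then have "clause_var C \<subseteq> v ` {1..k} \<union> Y ` {1..k} \<union> Z ` {1..k}" using S(6) that by blast
      also have "\<dots> \<subseteq> v ` {1..Suc k} \<union> Y ` {1..Suc k} \<union> Z ` {1..Suc k}" by auto
      finally show ?thesis .
    qed
    ultimately show ?case using N(1,5) S(2)
      by (intro exI[of _ "N \<union> S"] conjI ballI) auto
  qed
qed

text \<open>For m > 1 the six final clauses are added to the 18 * (m - 1) clauses present once
  \<open>Y m\<close> and \<open>Z m\<close> are equivalent; for m = 1 two units are added to four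
  axioms. Both cases give 18 * m - 12.\<close>

lemma derivation_units:
  "\<exists>S. derivation chains S \<and> card S = 18 * m - 12 \<and> (\<forall>C\<in>S. card C \<le> 3 \<and> C \<noteq> {}) \<and>
    {lt True (v (Suc m))} \<in> S \<and> {lt False (v (Suc m))} \<in> S"
proof (cases "m = 1")
  case True
  have d: "v 1 \<noteq> v 2" using True by simp
  have sub: "xor2 False (v 1) (v 2) \<subseteq> chains" "xor2 True (v 1) (v 2) \<subseteq> chains"
    using ends_subset_chains True Y1 Z1 by (simp_all add: numeral_2_eq_2)
  let ?S = "insert {lt False (v 2)} (insert {lt True (v 2)} chains)"
  have "derivation chains chains" by (simp add: derivation_axioms)
  from derivation_final_same[OF this d sub] have "derivation chains (insert {lt True (v 2)} chains)" .
  from derivation_final_same[OF this d] sub have "derivation chains ?S" by blast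
  moreover have "card ?S = 18 * m - 12"
  proof -
    have "{l} \<notin> chains" for l
      using card_in_link card_in_ends unfolding chains_def links_def by fastforce
    then have "card ?S = Suc (Suc (card chains))" by simp
    then show ?thesis using True card_chains by simp
  qed
  moreover have "\<forall>C\<in>?S. card C \<le> 3 \<and> C \<noteq> {}"
    using card_le_in_chains empty_notin_chains by auto
  ultimately show ?thesis using True
    by (intro exI[of _ ?S]) (auto simp: numeral_2_eq_2)
next
  case False
  then have m1: "1 < m" using m by simp
  obtain S where S: "derivation chains S" "chains \<subseteq> S"
      "card S = 8 * (m - 1) + 10 * (m - 1)" "\<forall>C\<in>S. card C \<le> 3 \<and> C \<noteq> {}"
      "xor2 False (Y m) (Z m) \<subseteq> S"
      "\<forall>C\<in>S - chains. clause_var C \<subseteq> v ` {1..m} \<union> Y ` {1..m} \<union> Z ` {1..m}"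
    using derivation_up_to[OF m1] by auto
  have d: "distinct [Y m, Z m, v (Suc m)]" using m1 by simp
  have sub: "xor2 False (Y m) (v (Suc m)) \<subseteq> S" "xor2 True (Z m) (v (Suc m)) \<subseteq> S"
    using ends_subset_chains S(2) by auto
  from derivation_final_set[OF S(1) d S(5) sub] obtain N where N:
    "derivation chains (N \<union> S)" "finite N" "card N = 6"
    "\<forall>C\<in>N. v (Suc m) \<in> clause_var C \<and> card C \<le> 3"
    "N \<inter> (xor2 False (Y m) (v (Suc m)) \<union> xor2 True (Z m) (v (Suc m))) = {}"
    "{lt True (v (Suc m))} \<in> N" "{lt False (v (Suc m))} \<in> N" by blast
  \<comment> \<open>Only the end constraints among the axioms contain \<open>v (Suc m)\<close>, and
    \<open>N\<close> avoids them.\<close>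
  have "N \<inter> chains = {}" using N(4,5) last_variable_in_chains unfolding ends_def by blast
  moreover have "v (Suc m) \<notin> v ` {1..m} \<union> Y ` {1..m} \<union> Z ` {1..m}" using m1 by auto
  then have "N \<inter> (S - chains) = {}" using N(4) S(6) by blast
  ultimately have disj: "N \<inter> S = {}" by blast
  then have "card (N \<union> S) = 18 * m - 12"
    using N S(3) m1 derivation_finite[OF S(1)] by (simp add: card_Un_disjoint)
  moreover have "\<forall>C\<in>N \<union> S. card C \<le> 3 \<and> C \<noteq> {}" using N(4) S(4) by auto
  ultimately show ?thesis using N by (intro exI[of _ "N \<union> S"]) blast
qed

section \<open>The refutation and the two width measures of the chains\<close>

lemma refutation_chains:
  "\<exists>Cs. resolution_refutation chains Cs \<and> distinct Cs \<and> length Cs = 18 * m - 11"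
proof -
  obtain S where S: "derivation chains S" "card S = 18 * m - 12" "\<forall>C\<in>S. card C \<le> 3 \<and> C \<noteq> {}"
    "{lt True (v (Suc m))} \<in> S" "{lt False (v (Suc m))} \<in> S" using derivation_units by blast
  have "Suc (18 * m - 12) = 18 * m - 11" using m by simp
  moreover have "{} \<notin> S" using S(3) by blast
  ultimately show ?thesis using derivation_refutation[OF S(1) _ S(4,5)] S(2) by metis
qed

lemma wid_derivable_3_chains: "wid_derivable 3 chains {}"
proof -
  obtain S where S: "derivation chains S" "\<forall>C\<in>S. card C \<le> 3 \<and> C \<noteq> {}"
    "{lt True (v (Suc m))} \<in> S" "{lt False (v (Suc m))} \<in> S" using derivation_units by blast
  then have "\<forall>C\<in>S. wid_derivable 3 chains C" using derivation_wid by blast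
  then have "wid_derivable 3 chains {lt True (v (Suc m))}"
    "wid_derivable 3 chains {lt (\<not> True) (v (Suc m))}" using S by simp_all
  from wid_derivable.wid_resolve[OF this resolvable_units(1)] show ?thesis
    using resolvable_units(2)[of True "v (Suc m)"] by simp
qed

text \<open>Both upper bounds come from the width-3 refutation, and both lower bounds from the
  impossibility of k = 2 for \<open>whd\<close>, using monotonicity in k.\<close>

lemma wid_whd_chains:
  assumes "1 < m"
  shows "whd chains = 3" "wid chains = 3"
proof -
  have low: "3 \<le> k" if "whd_derivable k chains {}" for k
    using that whd_mono[of k chains "{}" 2] not_whd_derivable_2_chains[OF assms] by fastforce
  show "whd chains = 3" unfolding whd_def
    using wid_imp_whd[OF wid_derivable_3_chains] low by (intro Least_equality) auto
  show "wid chains = 3" unfolding wid_def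
    using wid_derivable_3_chains low wid_imp_whd by (intro Least_equality) blast+
qed

end

section \<open>The clause-sets of the theorem\<close>

lemma Pos_eq_lt: "Pos x = lt True x" and Neg_eq_lt: "Neg x = lt False x"
  by (simp_all add: lt_def)

text \<open>With v_1 in the role of y_1, the first XOR-clause of the splitting becomes the case i =
  1 of the general one. For m = 1 the unsplit clause is already the final pair. The last literal
  \<open>xs ! m\<close> is left arbitrary to cover both signs.\<close>

lemma natural_splitting_eq:
  assumes m: "0 < m" and len: "length xs = Suc m"
    and xs: "\<And>i. 1 \<le> i \<Longrightarrow> i \<le> m \<Longrightarrow> xs ! (i - 1) = Pos (v i)"
    and Y: "Y = (\<lambda>i. if i = 1 then v 1 else y i)"
  shows "natural_splitting y xs =
    (\<lambda>i. {Pos (Y i), Pos (v (Suc i)), Pos (Y (Suc i))}) ` {1..<m} \<union> {{Pos (Y m), xs ! m}}"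
proof (cases "m = 1")
  case True
  then obtain a b where "xs = [a, b]" using len by (auto simp: length_Suc_conv)
  moreover have "xs ! 0 = Pos (v 1)" using xs[of 1] m by simp
  ultimately show ?thesis using True Y by (auto simp: natural_splitting_def)
next
  case False
  then have m2: "2 \<le> m" using m by simp
  let ?f = "\<lambda>i. {Pos (Y i), Pos (v (Suc i)), Pos (Y (Suc i))}"
  \<comment> \<open>The splitting numbers its middle clauses from 3 to m, the links from 2 to m - 1;
    the index 1 is the first clause.\<close>
  have "{1..<m} = insert 1 ((\<lambda>i. i - 1) ` {3..m})"
  proof (intro set_eqI iffI)
    fix i assume i: "i \<in> {1..<m}"
    show "i \<in> insert 1 ((\<lambda>i. i - 1) ` {3..m})"
    proof (cases "i = 1")
      case False
      then have "Suc i \<in> {3..m}" "i = Suc i - 1" using i by auto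
      then show ?thesis by blast
    qed simp
  qed (use m2 in auto)
  then have "?f ` {1..<m} = insert (?f 1) ((\<lambda>i. ?f (i - 1)) ` {3..m})"
    by (simp add: image_image)
  also have "(\<lambda>i. ?f (i - 1)) ` {3..m} = (\<lambda>i. {Pos (y (i - 1)), xs ! (i - 1), Pos (y i)}) ` {3..m}"
    using xs by (intro image_cong) (auto simp: Y)
  also have "\<dots> = {{Pos (y (i - 1)), xs ! (i - 1), Pos (y i)} | i. 3 \<le> i \<and> i \<le> m}"
    by auto
  also have "?f 1 = {xs ! (1 - 1), xs ! (2 - 1), Pos (y 2)}"
    using xs[of 1] xs[of 2] m2 by (simp add: Y numeral_2_eq_2)
  finally show ?thesis
    using m2 len by (simp add: natural_splitting_def Y)
qed

lemma X0_natural_splitting: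
  assumes "0 < m" "length xs = Suc m"
    and "\<And>i. 1 \<le> i \<Longrightarrow> i \<le> m \<Longrightarrow> xs ! (i - 1) = Pos (v i)" "xs ! m = lt s (v (Suc m))"
    and Y: "Y = (\<lambda>i. if i = 1 then v 1 else y i)"
    and ne: "\<And>i. 1 \<le> i \<Longrightarrow> i < m \<Longrightarrow> distinct [Y i, v (Suc i), Y (Suc i)]" "Y m \<noteq> v (Suc m)"
  shows "(\<Union>D\<in>natural_splitting y xs. X0 D) =
    (\<Union>i\<in>{1..<m}. xor3 (Y i) (v (Suc i)) (Y (Suc i))) \<union> xor2 (\<not> s) (Y m) (v (Suc m))"
proof -
  have "X0 {Pos (Y i), Pos (v (Suc i)), Pos (Y (Suc i))} = xor3 (Y i) (v (Suc i)) (Y (Suc i))"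
    if "i \<in> {1..<m}" for i
    using ne(1)[of i] that X0_triple[of "Y i" "v (Suc i)" "Y (Suc i)"] by (simp add: Pos_eq_lt)
  moreover have "X0 {Pos (Y m), xs ! m} = xor2 (\<not> s) (Y m) (v (Suc m))"
    using X0_pair[OF ne(2)] assms(4) by (simp add: Pos_eq_lt)
  moreover have "natural_splitting y xs =
      (\<lambda>i. {Pos (Y i), Pos (v (Suc i)), Pos (Y (Suc i))}) ` {1..<m} \<union> {{Pos (Y m), xs ! m}}"
    using assms(1-3) Y by (rule natural_splitting_eq)
  ultimately show ?thesis by (simp add: Un_commute)
qed

lemma T_eq_chains:
  fixes v :: "nat \<Rightarrow> 'a"
  assumes m: "0 < m" and n: "n = Suc m" and inj: "inj_on v {1..n}"
    and fresh: "fresh_aux aux {C1 v n, C2 v n}"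
  obtains Y Z where "split_chains v Y Z m" "T v aux n = split_chains.chains v Y Z m"
proof -
  have len: "length (C1 v n) = Suc m" "length (C2 v n) = Suc m" by (simp_all add: C1_def C2_def n)
  have nth1: "C1 v n ! (i - 1) = Pos (v i)" if "1 \<le> i" "i \<le> m" for i
    using that by (cases i) (simp_all add: C1_def n del: upt_Suc)
  have nth2: "C2 v n ! (i - 1) = Pos (v i)" if "1 \<le> i" "i \<le> m" for i
    using that by (cases i) (simp_all add: C2_def n nth_append del: upt_Suc)
  have last1: "C1 v n ! m = lt True (v (Suc m))"
    by (simp add: C1_def n lt_def nth_append del: upt_Suc)
  have last2: "C2 v n ! m = lt False (v (Suc m))" by (simp add: C2_def n lt_def nth_append)
  \<comment> \<open>Freshness separates the auxiliary variables of different lists only, so the two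
    lists must be shown to differ; their last literals do.\<close>
  have neq: "C1 v n \<noteq> C2 v n" using last1 last2 by auto
  have "v ` {1..n} \<subseteq> var (set ` {C1 v n, C2 v n})"
  proof -
    have "clause_var (set (C1 v n)) = v ` {1..n}"
      by (auto simp: C1_def clause_var_def image_image n simp del: upt_Suc)
    then show ?thesis by (auto simp: var_def)
  qed
  then have fr: "inj_on (aux (C1 v n)) {2..m}" "inj_on (aux (C2 v n)) {2..m}"
    "aux (C1 v n) ` {2..m} \<inter> v ` {1..n} = {}" "aux (C2 v n) ` {2..m} \<inter> v ` {1..n} = {}"
    "aux (C1 v n) ` {2..m} \<inter> aux (C2 v n) ` {2..m} = {}"
    using fresh neq len unfolding fresh_aux_def aux_vars_def by auto
  define Y where "Y = (\<lambda>i::nat. if i = 1 then v 1 else aux (C1 v n) i)"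
  define Z where "Z = (\<lambda>i::nat. if i = 1 then v 1 else aux (C2 v n) i)"
  have one: "{1..m} = insert 1 {2..m}" using m by auto
  have v1: "v 1 \<in> v ` {1..n}" using n by auto
  have inj_ext: "inj_on (\<lambda>i::nat. if i = 1 then v 1 else h i) {1..m}"
    if "inj_on h {2..m}" "h ` {2..m} \<inter> v ` {1..n} = {}" for h
  proof -
    have "v 1 \<noteq> h i" if "i \<in> {2..m}" for i
      using \<open>h ` {2..m} \<inter> v ` {1..n} = {}\<close> v1 that by (metis disjoint_iff imageI)
    moreover from this have "h i \<noteq> v 1" if "i \<in> {2..m}" for i using that by metis
    ultimately show ?thesis using \<open>inj_on h {2..m}\<close> unfolding inj_on_def one by simp
  qed
  interpret split_chains v Y Z m
  proof
    show "inj_on Y {1..m}" "inj_on Z {1..m}"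
      unfolding Y_def Z_def by (intro inj_ext fr)+
    show "Y i \<noteq> v j" if "2 \<le> i" "i \<le> m" "1 \<le> j" "j \<le> Suc m" for i j
    proof -
      have "aux (C1 v n) i \<in> aux (C1 v n) ` {2..m}" "v j \<in> v ` {1..n}" using that n by auto
      then have "aux (C1 v n) i \<noteq> v j" using fr(3) by (metis disjoint_iff)
      then show ?thesis using that by (simp add: Y_def)
    qed
    show "Z i \<noteq> v j" if "2 \<le> i" "i \<le> m" "1 \<le> j" "j \<le> Suc m" for i j
    proof -
      have "aux (C2 v n) i \<in> aux (C2 v n) ` {2..m}" "v j \<in> v ` {1..n}" using that n by auto
      then have "aux (C2 v n) i \<noteq> v j" using fr(4) by (metis disjoint_iff)
      then show ?thesis using that by (simp add: Z_def)
    qed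
    show "Y i \<noteq> Z j" if "2 \<le> i" "i \<le> m" "2 \<le> j" "j \<le> m" for i j
    proof -
      have "aux (C1 v n) i \<in> aux (C1 v n) ` {2..m}" "aux (C2 v n) j \<in> aux (C2 v n) ` {2..m}"
        using that by auto
      then have "aux (C1 v n) i \<noteq> aux (C2 v n) j" using fr(5) by (metis disjoint_iff)
      then show ?thesis using that by (simp add: Y_def Z_def)
    qed
  qed (use m inj n in \<open>simp_all add: Y_def Z_def\<close>)
  have "(\<Union>D\<in>natural_splitting (aux (C1 v n)) (C1 v n). X0 D) =
      (\<Union>i\<in>{1..<m}. xor3 (Y i) (v (Suc i)) (Y (Suc i))) \<union> xor2 (\<not> True) (Y m) (v (Suc m))"
    using m len(1) nth1 last1 Y_def by (rule X0_natural_splitting) (use m in simp_all)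
  moreover have "(\<Union>D\<in>natural_splitting (aux (C2 v n)) (C2 v n). X0 D) =
      (\<Union>i\<in>{1..<m}. xor3 (Z i) (v (Suc i)) (Z (Suc i))) \<union> xor2 (\<not> False) (Z m) (v (Suc m))"
    using m len(2) nth2 last2 Z_def by (rule X0_natural_splitting) (use m in simp_all)
  ultimately have "T v aux n = chains"
    unfolding T_def X1_def chains_def links_def link_def ends_def by auto
  then show ?thesis using that split_chains_axioms by blast
qed

lemma is_clause_in_T: "C \<in> T v aux n \<Longrightarrow> is_clause C"
  by (auto simp: T_def X1_def X0_def)

text \<open>The chains require m = n - 1 to be positive, so n = 1 is treated directly: both
  XOR-clauses are units and stay unsplit.\<close>

lemma T_1: "T v aux 1 = {{Pos (v 1)}, {Neg (v 1)}}"
proof -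
  have "natural_splitting y [l] = {{l}}" for y :: "nat \<Rightarrow> 'a" and l
    by (simp add: natural_splitting_def)
  then show ?thesis
    using X0_unit[of True "v 1"] X0_unit[of False "v 1"]
    by (auto simp: T_def X1_def C1_def C2_def Pos_eq_lt Neg_eq_lt)
qed

theorem theorem13p6:
  fixes v :: "nat \<Rightarrow> 'a" and aux :: "'a lit list \<Rightarrow> nat \<Rightarrow> 'a" and n :: nat
  assumes "1 \<le> n"
    and "inj_on v {1..n}"
    and "fresh_aux aux {C1 v n, C2 v n}"
  shows "(2 \<le> n \<longrightarrow> num_vars (T v aux n) = 3 * n - 4) \<and>
         (2 \<le> n \<longrightarrow> num_clauses (T v aux n) = 8 * n - 12) \<and>
         (2 \<le> n \<longrightarrow> num_lits (T v aux n) = 24 * n - 40) \<and>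
         (\<not> satisfiable (T v aux n) \<and> (\<forall>C\<in>T v aux n. card C \<le> 3)) \<and>
         (3 \<le> n \<longrightarrow> whd (T v aux n) = 3 \<and> wid (T v aux n) = 3) \<and>
         (2 \<le> n \<longrightarrow> (\<exists>Cs. resolution_refutation (T v aux n) Cs \<and> distinct Cs \<and>
                           length Cs = 18 * n - 29))"
proof (cases "n = 1")
  case True
  have "\<not> satisfiable (T v aux 1)" unfolding T_1 satisfiable_def by auto
  moreover have "\<forall>C\<in>T v aux 1. card C \<le> 3" unfolding T_1 by simp
  ultimately show ?thesis using True by simp
next
  case False
  then obtain m where n: "n = Suc m" "0 < m" using assms(1) by (cases n) auto
  obtain Y Z where YZ: "split_chains v Y Z m" and T: "T v aux n = split_chains.chains v Y Z m"
    using T_eq_chains[OF n(2,1) assms(2,3)] .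
  interpret split_chains v Y Z m by (rule YZ)
  \<comment> \<open>Unsatisfiability follows from soundness applied to the width-3 refutation, as
    all clauses of \<open>T\<close> are free of complementary pairs.\<close>
  have "\<not> satisfiable (T v aux n)"
    using wid_sound[OF wid_derivable_3_chains] is_clause_in_T[of _ v aux n]
    unfolding satisfiable_def T by blast
  then show ?thesis
    using n num_vars_chains card_chains num_lits_chains card_le_in_chains wid_whd_chains
      refutation_chains
    unfolding T num_clauses_def by auto
qed

end
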